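(* $d_0(P_2)=\Gamma_t(P_2)=d_0(P_4)=\Gamma_t(P_4)=2$, and $d_0(P_n)=\Gamma_t(P_n)+1$ if $n=3$ or $n\geq 5$.
   Context: $P_n$ is the path on $n$ vertices. A total dominating set (TDS) of a graph without isolated vertices is a vertex set $S$ such that every vertex is adjacent to a vertex of $S$; a minimal TDS is a TDS no proper subset of which is a TDS; $\Gamma_t(G)$ is the maximum cardinality of a minimal TDS. For a positive integer $k$, $D_k^t(G)$ is the graph whose vertices are the TDSs of $G$ of cardinality at most $k$, two being adjacent if and only if one is obtained from the other by adding or deleting a single vertex. $d_0(G)$ is the smallest integer $\ell$ such that $D_k^t(G)$ is connected for all $k\geq\ell$. *)

theory Defs
  imports "Graph_Theory.Graph_Theory"
begin

text \<open>
  A finite simple graph is a \<open>pair_graph\<close>: a finite, loopfree, symmetric digraph whose arcs are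
  pairs of vertices.
\<close>

definition path_graph :: "nat \<Rightarrow> nat pair_pre_digraph" where
  "path_graph n =
     \<lparr> pverts = {1..n},
       parcs = {(i, j). i \<in> {1..n} \<and> j \<in> {1..n} \<and> (j = i + 1 \<or> i = j + 1)} \<rparr>"

lemma pair_graph_path_graph: "pair_graph (path_graph n)"
proof -
  have "finite (parcs (path_graph n))"
    by (rule finite_subset[of _ "{1..n} \<times> {1..n}"]) (auto simp: path_graph_def)
  then show ?thesis
    by unfold_locales (auto simp: path_graph_def symmetric_def sym_def)
qed

definition total_dominating_set :: "'a pair_pre_digraph \<Rightarrow> 'a set \<Rightarrow> bool" where
  "total_dominating_set G S \<longleftrightarrow>
     S \<subseteq> pverts G \<and> (\<forall>v \<in> pverts G. \<exists>u \<in> S. v \<rightarrow>\<^bsub>G\<^esub> u)"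

definition minimal_total_dominating_set :: "'a pair_pre_digraph \<Rightarrow> 'a set \<Rightarrow> bool" where
  "minimal_total_dominating_set G S \<longleftrightarrow>
     total_dominating_set G S \<and> (\<forall>T. T \<subset> S \<longrightarrow> \<not> total_dominating_set G T)"

definition upper_total_domination_number :: "'a pair_pre_digraph \<Rightarrow> nat" where
  "upper_total_domination_number G = Max (card ` {S. minimal_total_dominating_set G S})"

definition tds_reconfiguration_graph ::
    "nat \<Rightarrow> 'a pair_pre_digraph \<Rightarrow> 'a set pair_pre_digraph" where
  "tds_reconfiguration_graph k G =
     (let V = {S. total_dominating_set G S \<and> card S \<le> k} in
      \<lparr> pverts = V,
        parcs = {(S, T). S \<in> V \<and> T \<in> V \<and>
                   ((\<exists>v. v \<notin> S \<and> T = insert v S) \<or> (\<exists>v. v \<in> S \<and> T = S - {v}))} \<rparr>)"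

text \<open>
  The reconfiguration graph is considered for positive \<open>k\<close> only. By the definition of
  \<open>connected\<close>, the graph without vertices is not connected, so \<open>d0 G\<close> is never smaller
  than the least size of a total dominating set.
\<close>

definition d0 :: "'a pair_pre_digraph \<Rightarrow> nat" where
  "d0 G = (LEAST l. 0 < l \<and> (\<forall>k \<ge> l. connected (tds_reconfiguration_graph k G)))"

end

theory Submission
  imports Defs
begin

text \<open>
  In \<open>P\<^sub>n\<close>, a vertex \<open>p\<close> lies only in the neighbourhoods \<open>{p - 2, p}\<close> and \<open>{p, p + 2}\<close> of
  \<open>p - 1\<close> and \<open>p + 1\<close>. Hence scanning the path from the left and discarding a vertex whenever
  this is possible produces a canonical total dominating set \<open>C\<close>, and a minimal total dominating
  set \<open>M\<close> whose first vertex outside \<open>C\<close> is \<open>p\<close> can be improved by adding \<open>p + 2\<close>, deleting \<open>p\<close>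
  and shrinking to a minimal set again. All sets on the way have at most \<open>\<Gamma>\<^sub>t + 1\<close> vertices, so
  everything is connected to \<open>C\<close> as soon as \<open>k > \<Gamma>\<^sub>t\<close>. Conversely, a minimal total dominating
  set of size \<open>\<Gamma>\<^sub>t\<close> is an isolated vertex for \<open>k = \<Gamma>\<^sub>t\<close>, and for \<open>n = 3\<close> or \<open>n \<ge> 5\<close> it is
  not the only vertex. For \<open>n = 2\<close> and \<open>n = 4\<close> there is only one minimal total dominating set.
\<close>

section \<open>Reconfiguration of total dominating sets\<close>

lemma total_dominating_set_superset:
  assumes "total_dominating_set G S" "S \<subseteq> T" "T \<subseteq> pverts G"
  shows "total_dominating_set G T"
  using assms unfolding total_dominating_set_def by blast

lemma total_dominating_set_imp_minimal:
  assumes "finite (pverts G)" "total_dominating_set G S"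
  obtains M where "minimal_total_dominating_set G M" "M \<subseteq> S"
proof -
  have "finite {T. total_dominating_set G T}"
    by (rule finite_subset[of _ "Pow (pverts G)"])
       (auto simp: total_dominating_set_def assms(1))
  from finite_has_minimal2[OF this, of S] assms(2) obtain M
    where "M \<in> {T. total_dominating_set G T}" "M \<subseteq> S"
      "\<forall>T \<in> {T. total_dominating_set G T}. T \<subseteq> M \<longrightarrow> M = T"
    by auto
  then show thesis
    by (intro that) (auto simp: minimal_total_dominating_set_def)
qed

lemma finite_minimal_total_dominating_sets:
  assumes "finite (pverts G)"
  shows "finite {S. minimal_total_dominating_set G S}"
  by (rule finite_subset[of _ "Pow (pverts G)"])
     (auto simp: minimal_total_dominating_set_def total_dominating_set_def assms)

lemma card_le_upper_total_domination_number:
  assumes "finite (pverts G)" "minimal_total_dominating_set G M"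
  shows "card M \<le> upper_total_domination_number G"
  unfolding upper_total_domination_number_def
  using assms finite_minimal_total_dominating_sets by (intro Max_ge) auto

lemma upper_total_domination_number_attained:
  assumes "finite (pverts G)" "total_dominating_set G S"
  obtains M where "minimal_total_dominating_set G M"
    "card M = upper_total_domination_number G"
proof -
  have "card ` {S. minimal_total_dominating_set G S} \<noteq> {}"
    using total_dominating_set_imp_minimal[OF assms] by blast
  then have "upper_total_domination_number G \<in> card ` {S. minimal_total_dominating_set G S}"
    unfolding upper_total_domination_number_def
    using assms(1) by (intro Max_in) (auto simp: finite_minimal_total_dominating_sets)
  then show thesis using that by auto
qed

section \<open>Connectivity of the reconfiguration graph of an arbitrary graph\<close>

lemma pverts_tds_reconfiguration_graph [simp]:
  "pverts (tds_reconfiguration_graph k G) = {S. total_dominating_set G S \<and> card S \<le> k}"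
  by (simp add: tds_reconfiguration_graph_def Let_def)

lemma parcs_tds_reconfiguration_graph:
  "(S, T) \<in> parcs (tds_reconfiguration_graph k G) \<longleftrightarrow>
     total_dominating_set G S \<and> card S \<le> k \<and> total_dominating_set G T \<and> card T \<le> k \<and>
     ((\<exists>v. v \<notin> S \<and> T = insert v S) \<or> (\<exists>v. v \<in> S \<and> T = S - {v}))"
  by (auto simp: tds_reconfiguration_graph_def Let_def)

lemma pair_wf_digraph_tds_reconfiguration_graph:
  "pair_wf_digraph (tds_reconfiguration_graph k G)"
  by unfold_locales (auto simp: parcs_tds_reconfiguration_graph)

lemma symmetric_tds_reconfiguration_graph:
  "symmetric (tds_reconfiguration_graph k G)"
  unfolding symmetric_def
proof (rule symI)
  fix S T
  assume "(S, T) \<in> arcs_ends (tds_reconfiguration_graph k G)"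
  then show "(T, S) \<in> arcs_ends (tds_reconfiguration_graph k G)"
    by (simp add: parcs_tds_reconfiguration_graph) blast
qed

text \<open>\<open>connected\<close> refers to the symmetric closure, which adds nothing here
  because every arc is already present in both directions.\<close>

lemma connected_tds_reconfiguration_graph_iff:
  "connected (tds_reconfiguration_graph k G) \<longleftrightarrow>
     strongly_connected (tds_reconfiguration_graph k G)"
proof -
  interpret pair_wf_digraph "tds_reconfiguration_graph k G"
    by (rule pair_wf_digraph_tds_reconfiguration_graph)
  show ?thesis
    unfolding connected_def strongly_connected_def
    using reachable_mk_symmetric_eq[OF symmetric_tds_reconfiguration_graph] by simp
qed

lemma tds_reconfiguration_graph_connectedI:
  assumes "total_dominating_set G C" "card C \<le> k"
    and "\<And>S. total_dominating_set G S \<Longrightarrow> card S \<le> k \<Longrightarrow>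
      S \<rightarrow>\<^sup>*\<^bsub>tds_reconfiguration_graph k G\<^esub> C"
  shows "connected (tds_reconfiguration_graph k G)"
proof -
  interpret pair_wf_digraph "tds_reconfiguration_graph k G"
    by (rule pair_wf_digraph_tds_reconfiguration_graph)
  have "S \<rightarrow>\<^sup>*\<^bsub>tds_reconfiguration_graph k G\<^esub> T"
    if "total_dominating_set G S" "card S \<le> k" "total_dominating_set G T" "card T \<le> k" for S T
    using assms(3)[OF that(1,2)]
      symmetric_reachable[OF symmetric_tds_reconfiguration_graph assms(3)[OF that(3,4)]]
    by (rule reachable_trans)
  then show ?thesis
    using assms(1,2)
    by (auto simp: connected_tds_reconfiguration_graph_iff strongly_connected_def)
qed

text \<open>The vertices of \<open>S - T\<close> are deleted one by one; each intermediate set lies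
  between \<open>T\<close> and \<open>S\<close>, so it dominates and has at most \<open>k\<close>
  elements. The induction builds the route backwards from \<open>T\<close>.\<close>

lemma tds_reachable_subset:
  assumes "finite (pverts G)" "total_dominating_set G T" "T \<subseteq> S" "S \<subseteq> pverts G" "card S \<le> k"
  shows "S \<rightarrow>\<^sup>*\<^bsub>tds_reconfiguration_graph k G\<^esub> T"
proof -
  interpret pair_wf_digraph "tds_reconfiguration_graph k G"
    by (rule pair_wf_digraph_tds_reconfiguration_graph)
  have "finite S" using assms(1,4) by (rule rev_finite_subset)
  then have "finite (S - T)" by simp
  moreover have "total_dominating_set G (T \<union> A) \<and> (T \<union> A) \<rightarrow>\<^sup>*\<^bsub>tds_reconfiguration_graph k G\<^esub> T"
    if "A \<subseteq> S - T" for A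
    using finite_subset[OF that \<open>finite (S - T)\<close>] that
  proof (induction A rule: finite_induct)
    case empty
    have "card T \<le> k" using assms(3,5) card_mono[OF \<open>finite S\<close>] by (meson le_trans)
    then show ?case using assms(2) by (auto intro: reachable_refl)
  next
    case (insert a A)
    have sub: "T \<union> insert a A \<subseteq> S" using insert.prems assms(3) by blast
    have 1: "card B \<le> k" if "B \<subseteq> S" for B
      using assms(5) card_mono[OF \<open>finite S\<close> that] by simp
    have 2: "total_dominating_set G (T \<union> insert a A)"
      using total_dominating_set_superset[OF assms(2)] sub assms(4) by blast
    have "T \<union> A = (T \<union> insert a A) - {a}" "a \<in> T \<union> insert a A"
      using insert.hyps(2) insert.prems by auto
    then have "(T \<union> insert a A) \<rightarrow>\<^bsub>tds_reconfiguration_graph k G\<^esub> (T \<union> A)"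
      using 1[OF sub] 1[of "T \<union> A"] 2 sub insert
      by (simp add: parcs_tds_reconfiguration_graph) blast
    moreover have "(T \<union> A) \<rightarrow>\<^sup>*\<^bsub>tds_reconfiguration_graph k G\<^esub> T"
      using insert by blast
    ultimately show ?case
      using 2 adj_reachable_trans by simp
  qed
  ultimately show ?thesis
    using assms(3) by (metis Un_Diff_cancel sup.absorb_iff2 subset_refl)
qed

text \<open>A minimal set of maximum size is isolated at this threshold: a deletion destroys
  domination and an addition exceeds the bound. The sets \<open>A\<close> and \<open>B\<close> serve
  to produce a second vertex of the graph.\<close>

lemma not_connected_upper_total_domination_number:
  assumes fin: "finite (pverts G)"
    and A: "total_dominating_set G A" and B: "total_dominating_set G B"
    and AB: "\<not> total_dominating_set G (A \<inter> B)"
  shows "\<not> connected (tds_reconfiguration_graph (upper_total_domination_number G) G)"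
proof
  let ?\<Gamma> = "upper_total_domination_number G"
  assume conn: "connected (tds_reconfiguration_graph ?\<Gamma> G)"
  interpret pair_wf_digraph "tds_reconfiguration_graph ?\<Gamma> G"
    by (rule pair_wf_digraph_tds_reconfiguration_graph)
  obtain M where M: "minimal_total_dominating_set G M" "card M = ?\<Gamma>"
    using upper_total_domination_number_attained[OF fin A] .
  obtain A' where A': "minimal_total_dominating_set G A'" "A' \<subseteq> A"
    using total_dominating_set_imp_minimal[OF fin A] .
  obtain B' where B': "minimal_total_dominating_set G B'" "B' \<subseteq> B"
    using total_dominating_set_imp_minimal[OF fin B] .
  \<comment> \<open>A common minimal set would lie in \<open>A \<inter> B\<close> and make it
    dominating.\<close>
  have "A' \<noteq> B'"
    using AB A B A' B' total_dominating_set_superset[of G A' "A \<inter> B"]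
    by (auto simp: minimal_total_dominating_set_def total_dominating_set_def[of G A])
  then obtain N where N: "minimal_total_dominating_set G N" "N \<noteq> M"
    using A' B' by metis
  have tds: "total_dominating_set G M" "total_dominating_set G N"
    using M N by (simp_all add: minimal_total_dominating_set_def)
  have "M \<rightarrow>\<^sup>*\<^bsub>tds_reconfiguration_graph ?\<Gamma> G\<^esub> N"
    using conn tds card_le_upper_total_domination_number[OF fin] M N
    by (simp add: connected_tds_reconfiguration_graph_iff strongly_connected_def)
  then obtain T where T: "M \<rightarrow>\<^bsub>tds_reconfiguration_graph ?\<Gamma> G\<^esub> T"
    using N(2) by (auto elim: converse_reachable_cases)
  have "finite M" using fin tds(1) finite_subset by (auto simp: total_dominating_set_def)
  with T M show False
    by (auto simp: parcs_tds_reconfiguration_graph minimal_total_dominating_set_def)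
qed

text \<open>From \<open>card F\<close> on, every vertex shrinks to \<open>F\<close>. Below
  \<open>card F\<close> the graph has no vertices, hence is not connected.\<close>

lemma unique_minimal_total_dominating_set:
  assumes fin: "finite (pverts G)" and F: "total_dominating_set G F" "F \<noteq> {}"
    and sub: "\<And>S. total_dominating_set G S \<Longrightarrow> F \<subseteq> S"
  shows "d0 G = card F" "upper_total_domination_number G = card F"
proof -
  have "finite F" using fin F(1) finite_subset by (auto simp: total_dominating_set_def)
  have "{S. minimal_total_dominating_set G S} = {F}"
    using F(1) sub unfolding minimal_total_dominating_set_def by (blast intro: antisym)
  then show "upper_total_domination_number G = card F"
    by (simp add: upper_total_domination_number_def)
  have conn: "connected (tds_reconfiguration_graph k G)" if "card F \<le> k" for k
    using F(1) that
  proof (rule tds_reconfiguration_graph_connectedI)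
    fix S
    assume "total_dominating_set G S" "card S \<le> k"
    then show "S \<rightarrow>\<^sup>*\<^bsub>tds_reconfiguration_graph k G\<^esub> F"
      using tds_reachable_subset[OF fin F(1) sub] by (simp add: total_dominating_set_def)
  qed
  have "card F \<le> l" if conn_l: "connected (tds_reconfiguration_graph l G)" for l
  proof -
    obtain S where "total_dominating_set G S" "card S \<le> l"
      using conn_l by (auto simp: connected_tds_reconfiguration_graph_iff strongly_connected_def)
    moreover from this have "finite S"
      using fin finite_subset by (auto simp: total_dominating_set_def)
    ultimately show ?thesis using sub card_mono le_trans by metis
  qed
  then show "d0 G = card F"
    unfolding d0_def using conn F(2) \<open>finite F\<close>
    by (intro Least_equality) (auto simp: card_gt_0_iff)
qed

section \<open>Paths\<close>

lemma pverts_path_graph [simp]: "pverts (path_graph n) = {1..n}"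
  by (simp add: path_graph_def)

text \<open>The ends need no special case: \<open>S\<close> contains neither 0 nor
  \<open>n + 1\<close>, so the missing neighbour never counts.\<close>

lemma total_dominating_set_path_graph_iff:
  "total_dominating_set (path_graph n) S \<longleftrightarrow>
     S \<subseteq> {1..n} \<and> (\<forall>v \<in> {1..n}. v + 1 \<in> S \<or> v - 1 \<in> S)"
proof -
  have "(\<exists>u \<in> S. v \<rightarrow>\<^bsub>path_graph n\<^esub> u) \<longleftrightarrow> v + 1 \<in> S \<or> v - 1 \<in> S"
    if "S \<subseteq> {1..n}" "v \<in> {1..n}" for v
    using that by (force simp: path_graph_def)
  then show ?thesis unfolding total_dominating_set_def pverts_path_graph by blast
qed

text \<open>Closed form of the result of the left-to-right scan: the pattern has period 4, and
  \<open>n - 1\<close> is forced as the only neighbour of \<open>n\<close>.\<close>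

definition greedy_tds :: "nat \<Rightarrow> nat set" where
  "greedy_tds n = {p \<in> {1..n}. p mod 4 = 2 \<or> p mod 4 = 3 \<or> p = n - 1}"

text \<open>This is why residues 2 and 3 suffice away from the right end: of the two neighbours of
  \<open>w + 1\<close>, exactly one is chosen.\<close>

lemma mod_4_add_2:
  fixes w :: nat
  shows "(w + 2) mod 4 = 2 \<or> (w + 2) mod 4 = 3 \<longleftrightarrow> \<not> (w mod 4 = 2 \<or> w mod 4 = 3)"
  by presburger

lemma total_dominating_set_greedy_tds:
  assumes "n \<ge> 2"
  shows "total_dominating_set (path_graph n) (greedy_tds n)"
  unfolding total_dominating_set_path_graph_iff
proof (intro conjI ballI)
  show "greedy_tds n \<subseteq> {1..n}" by (auto simp: greedy_tds_def)
  fix v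
  assume "v \<in> {1..n}"
  then have v: "1 \<le> v" "v \<le> n" by auto
  show "v + 1 \<in> greedy_tds n \<or> v - 1 \<in> greedy_tds n"
  proof (cases "v = n \<or> \<not> ((v + 1) mod 4 = 2 \<or> (v + 1) mod 4 = 3)")
    case True
    obtain w where w: "v = w + 1" using v(1) by (metis add.commute le_Suc_ex)
    with True have "w = n - 1 \<or> w mod 4 = 2 \<or> w mod 4 = 3"
      using mod_4_add_2[of w] by auto
    moreover from this have "w \<noteq> 0" using assms by auto
    ultimately show ?thesis using v w by (auto simp: greedy_tds_def)
  next
    case False
    then show ?thesis using v by (auto simp: greedy_tds_def)
  qed
qed

text \<open>Only \<open>p - 1\<close> and \<open>p + 1\<close> can lose their dominator. The latter
  gets \<open>p + 2\<close>, the former keeps \<open>p - 2\<close>. The intersection drops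
  \<open>p + 2\<close> when it is off the path.\<close>

lemma path_tds_remove:
  assumes S: "total_dominating_set (path_graph n) S"
    and below: "\<And>q. q \<in> S \<Longrightarrow> q < p \<Longrightarrow> q \<in> greedy_tds n"
    and p: "p \<in> S" "p \<notin> greedy_tds n"
  shows "total_dominating_set (path_graph n) (({p + 2} \<inter> {1..n} \<union> S) - {p})"
proof -
  have range: "p \<in> {1..n}"
    using S p by (auto simp: total_dominating_set_path_graph_iff)
  have dom: "v + 1 \<in> S \<or> v - 1 \<in> S" if "v \<in> {1..n}" for v
    using S that by (auto simp: total_dominating_set_path_graph_iff)
  have pmod: "\<not> (p mod 4 = 2 \<or> p mod 4 = 3)" and "p \<noteq> n - 1"
    using p range by (simp_all add: greedy_tds_def)
  \<comment> \<open>The vertex \<open>p - 3\<close> needs \<open>p - 4\<close> or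
    \<open>p - 2\<close>. Since \<open>p - 4\<close> has the residue of \<open>p\<close> and is less
    than \<open>n - 1\<close>, it is not in the canonical set, so \<open>below\<close> keeps it out
    of \<open>S\<close>.\<close>
  have left: "p - 2 \<in> S" if "p \<noteq> 1"
  proof -
    have "p \<noteq> 2" "p \<noteq> 3" using pmod by auto
    then have "p \<ge> 4" using that range by auto
    then obtain q where q: "p = q + 4" by (metis add.commute le_Suc_ex)
    then have "\<not> (q mod 4 = 2 \<or> q mod 4 = 3)" using pmod by simp
    then have "q \<notin> S" using below[of q] range q by (auto simp: greedy_tds_def)
    then show ?thesis using dom[of "q + 1"] range q by auto
  qed
  have "v + 1 \<in> ({p + 2} \<inter> {1..n} \<union> S) - {p} \<or> v - 1 \<in> ({p + 2} \<inter> {1..n} \<union> S) - {p}"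
    if v: "v \<in> {1..n}" for v
  proof -
    consider "v + 1 = p" | "v = p + 1" | "v + 1 \<noteq> p" "v - 1 \<noteq> p"
      using v range by force
    then show ?thesis
    proof cases
      case 1
      then have "v - 1 = p - 2" "p \<noteq> 1" using v by auto
      then show ?thesis using left range by auto
    next
      case 2
      \<comment> \<open>As \<open>n - 1\<close> is canonical, \<open>p + 1\<close> is not the last
        vertex.\<close>
      then have "p + 2 \<le> n" using v \<open>p \<noteq> n - 1\<close> by auto
      then show ?thesis using 2 by auto
    next
      case 3
      then show ?thesis using dom[OF v] by auto
    qed
  qed
  moreover have "({p + 2} \<inter> {1..n} \<union> S) - {p} \<subseteq> {1..n}"
    using S by (auto simp: total_dominating_set_path_graph_iff)
  ultimately show ?thesis by (simp only: total_dominating_set_path_graph_iff) blast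
qed

text \<open>Each canonical vertex is the only canonical neighbour of some vertex:
  \<open>n - 1\<close> of \<open>n\<close>, and any other \<open>p\<close> of \<open>p - 1\<close>,
  because \<open>p - 2\<close> is not canonical.\<close>

lemma greedy_tds_minimal:
  assumes "n \<ge> 2" "total_dominating_set (path_graph n) S" "S \<subseteq> greedy_tds n"
  shows "S = greedy_tds n"
proof (rule ccontr)
  assume "S \<noteq> greedy_tds n"
  then obtain p where p: "p \<in> greedy_tds n" "p \<notin> S" using assms(3) by blast
  have dom: "v + 1 \<in> S \<or> v - 1 \<in> S" if "v \<in> {1..n}" for v
    using assms(2) that by (auto simp: total_dominating_set_path_graph_iff)
  show False
  proof (cases "p = n - 1")
    case True
    have "n + 1 \<notin> S" using assms(2) by (auto simp: total_dominating_set_path_graph_iff)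
    then show False using dom[of n] True p assms(1) by auto
  next
    case False
    with p have pmod: "p mod 4 = 2 \<or> p mod 4 = 3" and "p \<in> {1..n}"
      by (auto simp: greedy_tds_def)
    then have "p \<ge> 2" by (cases "p = 1") auto
    then obtain q where q: "p = q + 2" by (metis add.commute le_Suc_ex)
    then have "q \<notin> greedy_tds n"
      using pmod mod_4_add_2[of q] \<open>p \<in> {1..n}\<close> by (auto simp: greedy_tds_def)
    then have "q \<notin> S" using assms(3) by blast
    then show False using dom[of "q + 1"] p(2) q \<open>p \<in> {1..n}\<close> by auto
  qed
qed

text \<open>Induction on the length of the prefix on which \<open>S\<close> contains only canonical
  vertices. At \<open>p = n + 1\<close> all of \<open>S\<close> is canonical, and minimality gives
  equality.\<close>

lemma path_reachable_greedy_tds: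
  assumes n: "n \<ge> 2" and k: "upper_total_domination_number (path_graph n) < k"
    and p: "p \<le> n + 1"
    and S: "total_dominating_set (path_graph n) S" "card S \<le> k"
    and below: "\<And>q. q \<in> S \<Longrightarrow> q < p \<Longrightarrow> q \<in> greedy_tds n"
  shows "S \<rightarrow>\<^sup>*\<^bsub>tds_reconfiguration_graph k (path_graph n)\<^esub> greedy_tds n"
  using p S below
proof (induction p arbitrary: S rule: inc_induct)
  case base
  interpret pair_wf_digraph "tds_reconfiguration_graph k (path_graph n)"
    by (rule pair_wf_digraph_tds_reconfiguration_graph)
  have "S \<subseteq> greedy_tds n"
    using base by (auto simp: total_dominating_set_path_graph_iff subset_iff)
  then have "S = greedy_tds n" using greedy_tds_minimal[OF n] base by blast
  then show ?case using base by (auto intro: reachable_refl)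
next
  case (step p)
  let ?D = "tds_reconfiguration_graph k (path_graph n)"
  interpret pair_wf_digraph ?D
    by (rule pair_wf_digraph_tds_reconfiguration_graph)
  have fin: "finite (pverts (path_graph n))" by simp
  obtain M where M: "minimal_total_dominating_set (path_graph n) M" "M \<subseteq> S"
    using total_dominating_set_imp_minimal[OF fin step.prems(1)] .
  have tdsM: "total_dominating_set (path_graph n) M"
    using M by (simp add: minimal_total_dominating_set_def)
  then have "M \<subseteq> {1..n}" "finite M"
    by (auto simp: total_dominating_set_path_graph_iff intro: finite_subset)
  \<comment> \<open>Strictness leaves room for the one extra vertex \<open>p + 2\<close>.\<close>
  have cardM: "card M < k"
    using card_le_upper_total_domination_number[OF fin M(1)] k by linarith
  have SM: "S \<rightarrow>\<^sup>*\<^bsub>?D\<^esub> M"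
    using tds_reachable_subset[OF fin tdsM M(2)] step.prems(1,2)
    by (auto simp: total_dominating_set_def)
  have belowM: "q \<in> greedy_tds n" if "q \<in> M" "q < p" for q
    using step.prems(3) M(2) that by blast
  have "M \<rightarrow>\<^sup>*\<^bsub>?D\<^esub> greedy_tds n"
  proof (cases "p \<in> M \<and> p \<notin> greedy_tds n")
    case True
    define U where "U = {p + 2} \<inter> {1..n} \<union> M"
    have U: "M \<subseteq> U" "U \<subseteq> {1..n}" "card U \<le> k"
      using \<open>M \<subseteq> {1..n}\<close> \<open>finite M\<close> cardM by (auto simp: U_def Int_insert_left card_insert_if)
    have tdsN: "total_dominating_set (path_graph n) (U - {p})"
      using path_tds_remove[OF tdsM belowM] True by (simp add: U_def)
    have "U \<rightarrow>\<^sup>*\<^bsub>?D\<^esub> M" "U \<rightarrow>\<^sup>*\<^bsub>?D\<^esub> (U - {p})"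
      using tds_reachable_subset[OF fin] tdsM tdsN U by auto
    moreover from this have "M \<rightarrow>\<^sup>*\<^bsub>?D\<^esub> U"
      using symmetric_reachable[OF symmetric_tds_reconfiguration_graph] by blast
    moreover have "(U - {p}) \<rightarrow>\<^sup>*\<^bsub>?D\<^esub> greedy_tds n"
    proof (rule step.IH[OF tdsN])
      show "card (U - {p}) \<le> k" using U(3) card_Diff1_le[of U p] by linarith
      \<comment> \<open>The added vertex \<open>p + 2\<close> lies beyond the new prefix, so it
        cannot spoil it.\<close>
      show "q \<in> greedy_tds n" if "q \<in> U - {p}" "q < Suc p" for q
        using that belowM by (auto simp: U_def)
    qed
    ultimately show ?thesis using reachable_trans by metis
  next
    case False
    then show ?thesis
      using step.IH[OF tdsM] cardM belowM by (auto simp: less_Suc_eq)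
  qed
  with SM show ?case by (rule reachable_trans)
qed

lemma path_connected:
  assumes n: "n \<ge> 2" and k: "upper_total_domination_number (path_graph n) < k"
  shows "connected (tds_reconfiguration_graph k (path_graph n))"
proof (rule tds_reconfiguration_graph_connectedI)
  show tds: "total_dominating_set (path_graph n) (greedy_tds n)"
    using n by (rule total_dominating_set_greedy_tds)
  have "minimal_total_dominating_set (path_graph n) (greedy_tds n)"
    unfolding minimal_total_dominating_set_def using tds greedy_tds_minimal[OF n] by blast
  then show "card (greedy_tds n) \<le> k"
    using card_le_upper_total_domination_number[of "path_graph n"] k by fastforce
  show "S \<rightarrow>\<^sup>*\<^bsub>tds_reconfiguration_graph k (path_graph n)\<^esub> greedy_tds n"
    if "total_dominating_set (path_graph n) S" "card S \<le> k" for S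
    \<comment> \<open>For \<open>p = 0\<close> the prefix condition is vacuous.\<close>
    using path_reachable_greedy_tds[OF n k, of 0] that by simp
qed

section \<open>The values of \<open>d0\<close> on paths\<close>

lemma d0_path_graph:
  assumes n: "n = 3 \<or> n \<ge> 5"
  shows "d0 (path_graph n) = upper_total_domination_number (path_graph n) + 1"
  unfolding d0_def
proof (rule Least_equality)
  let ?\<Gamma> = "upper_total_domination_number (path_graph n)"
  show "0 < ?\<Gamma> + 1 \<and> (\<forall>k \<ge> ?\<Gamma> + 1. connected (tds_reconfiguration_graph k (path_graph n)))"
    using path_connected[of n] n by auto
  fix l
  assume l: "0 < l \<and> (\<forall>k \<ge> l. connected (tds_reconfiguration_graph k (path_graph n)))"
  \<comment> \<open>The neighbours of 2 are 1 and 3: either may be missing, but not both. For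
    \<open>n = 4\<close> this fails, since 3 is the only neighbour of 4.\<close>
  have "total_dominating_set (path_graph n) ({1..n} - {1})"
    "total_dominating_set (path_graph n) ({1..n} - {3})"
    using n by (auto simp: total_dominating_set_path_graph_iff)
  moreover have "\<not> total_dominating_set (path_graph n) (({1..n} - {1}) \<inter> ({1..n} - {3}))"
  proof -
    have "2 \<in> {1..n}" using n by auto
    moreover have "2 + 1 \<notin> ({1..n} - {1}) \<inter> ({1..n} - {3})"
      "2 - 1 \<notin> ({1..n} - {1}) \<inter> ({1..n} - {3})" by auto
    ultimately show ?thesis unfolding total_dominating_set_path_graph_iff by blast
  qed
  ultimately have "\<not> connected (tds_reconfiguration_graph ?\<Gamma> (path_graph n))"
    by (intro not_connected_upper_total_domination_number) auto
  with l show "?\<Gamma> + 1 \<le> l" by (metis Suc_eq_plus1 not_less_eq_eq)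
qed

theorem theorem3p10:
  shows "d0 (path_graph 2) = 2 \<and> upper_total_domination_number (path_graph 2) = 2 \<and>
         d0 (path_graph 4) = 2 \<and> upper_total_domination_number (path_graph 4) = 2 \<and>
         (\<forall>n. n = 3 \<or> n \<ge> 5 \<longrightarrow>
            d0 (path_graph n) = upper_total_domination_number (path_graph n) + 1)"
proof -
  have "total_dominating_set (path_graph 2) {1, 2}"
    by (auto simp: total_dominating_set_path_graph_iff)
  \<comment> \<open>Both vertices are leaves, and each forces the other.\<close>
  moreover have "{1, 2} \<subseteq> S" if "total_dominating_set (path_graph 2) S" for S
  proof -
    have "S \<subseteq> {1..2}" and dom: "\<And>v. v \<in> {1..2} \<Longrightarrow> v + 1 \<in> S \<or> v - 1 \<in> S"
      using that unfolding total_dominating_set_path_graph_iff by blast+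
    moreover have "1 + 1 \<in> S \<or> 1 - 1 \<in> S" "2 + 1 \<in> S \<or> 2 - 1 \<in> S"
      by (rule dom, simp)+
    ultimately show ?thesis by (auto simp: numeral_2_eq_2)
  qed
  ultimately have P2: "d0 (path_graph 2) = card {1, 2::nat}"
    "upper_total_domination_number (path_graph 2) = card {1, 2::nat}"
    by (intro unique_minimal_total_dominating_set; simp)+
  have "total_dominating_set (path_graph 4) {2, 3}"
    by (auto simp: total_dominating_set_path_graph_iff)
  \<comment> \<open>The leaves 1 and 4 force their only neighbours 2 and 3.\<close>
  moreover have "{2, 3} \<subseteq> S" if "total_dominating_set (path_graph 4) S" for S
  proof -
    have "S \<subseteq> {1..4}" and dom: "\<And>v. v \<in> {1..4} \<Longrightarrow> v + 1 \<in> S \<or> v - 1 \<in> S"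
      using that unfolding total_dominating_set_path_graph_iff by blast+
    moreover have "1 + 1 \<in> S \<or> 1 - 1 \<in> S" "4 + 1 \<in> S \<or> 4 - 1 \<in> S"
      by (rule dom, simp)+
    ultimately show ?thesis by (auto simp: numeral_2_eq_2)
  qed
  ultimately have P4: "d0 (path_graph 4) = card {2, 3::nat}"
    "upper_total_domination_number (path_graph 4) = card {2, 3::nat}"
    by (intro unique_minimal_total_dominating_set; simp)+
  show ?thesis using P2 P4 d0_path_graph by simp
qed

end
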